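(* Let $k \ge 1$ be an integer and let $p^{(1)},\dots,p^{(k)}$ be everywhere positive probability densities on $\mathcal{X}$ with respect to the reference measure $\mathrm{d}\mathbf{x}$. Let $r$ be a real number with $0 \le r \le 1$, and let $\overset{\circ}{p}_{k,r}$ be the normalized generalized mean of order $r$ of $p^{(1)},\dots,p^{(k)}$. Then for every $\mathbf{x} \in \mathcal{X}$, $$\log \overset{\circ}{p}_{k,r}(\mathbf{x}) \;\ge\; \frac{1}{k}\sum_{i=1}^k \log p^{(i)}(\mathbf{x}).$$
   Context: $\mathcal{X}$ is a data space (a measurable space) equipped with a reference measure $\mathrm{d}\mathbf{x}$. A probability density is a measurable function $p:\mathcal{X}\to\mathbb{R}_{\ge 0}$ with $\int_{\mathcal{X}} p(\mathbf{x})\,\mathrm{d}\mathbf{x}=1$. For positive reals $a_1,\dots,a_k$, the generalized (power) mean of order $r$ is $M_r(a_1,\dots,a_k)=\left(\frac1k\sum_{i=1}^k a_i^r\right)^{1/r}$ for $r\in\mathbb{R}\setminus\{0\}$, and $M_0(a_1,\dots,a_k)=\left(\prod_{i=1}^k a_i\right)^{1/k}$. For densities $p^{(1)},\dots,p^{(k)}$ define pointwise $M_{k,r}(\mathbf{x})=M_r\big(p^{(1)}(\mathbf{x}),\dots,p^{(k)}(\mathbf{x})\big)$, the normalization constant $Z_{k,r}=\int_{\mathcal{X}} M_{k,r}(\mathbf{x})\,\mathrm{d}\mathbf{x}$, and the normalized generalized mean of order $r$ $$\overset{\circ}{p}_{k,r}(\mathbf{x})=\frac{M_{k,r}(\mathbf{x})}{Z_{k,r}}.$$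 *)

theory Defs
  imports "HOL-Analysis.Analysis"
begin

(* The value 1 of the Bochner integral already forces integrability, because the
   integral of a non-integrable function is 0. *)
definition prob_density :: "'a measure \<Rightarrow> ('a \<Rightarrow> real) \<Rightarrow> bool" where
  "prob_density M p \<longleftrightarrow>
     p \<in> borel_measurable M \<and> (\<forall>x\<in>space M. 0 \<le> p x) \<and> (\<integral>x. p x \<partial>M) = 1"

(* Only meant for k \<ge> 1 and positive a 1, ..., a k, where powr is the usual real power. *)
definition gen_mean :: "real \<Rightarrow> nat \<Rightarrow> (nat \<Rightarrow> real) \<Rightarrow> real" where
  "gen_mean r k a =
     (if r = 0 then (\<Prod>i=1..k. a i) powr (1 / real k)
      else ((1 / real k) * (\<Sum>i=1..k. a i powr r)) powr (1 / r))"

definition pointwise_mean :: "nat \<Rightarrow> real \<Rightarrow> (nat \<Rightarrow> 'a \<Rightarrow> real) \<Rightarrow> 'a \<Rightarrow> real" where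
  "pointwise_mean k r p x = gen_mean r k (\<lambda>i. p i x)"

(* For positive densities the pointwise mean lies between 0 and the sum of the p i, for every
   real r, so it is integrable and this integral is never the default value 0. *)
definition norm_const :: "'a measure \<Rightarrow> nat \<Rightarrow> real \<Rightarrow> (nat \<Rightarrow> 'a \<Rightarrow> real) \<Rightarrow> real" where
  "norm_const M k r p = (\<integral>x. pointwise_mean k r p x \<partial>M)"

definition normalized_mean ::
    "'a measure \<Rightarrow> nat \<Rightarrow> real \<Rightarrow> (nat \<Rightarrow> 'a \<Rightarrow> real) \<Rightarrow> 'a \<Rightarrow> real" where
  "normalized_mean M k r p x = pointwise_mean k r p x / norm_const M k r p"

end

(* The power mean is monotone in its order: geometric mean <= M_r <= arithmetic mean
   for 0 <= r <= 1. The right inequality integrates to Z <= 1, so dividing M_r by Z only increases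
   it, and the left inequality is the claim. *)
theory Submission
  imports Defs
begin

lemma gen_mean_pos:
  assumes "k \<ge> 1" and "\<And>i. i \<in> {1..k} \<Longrightarrow> a i > 0"
  shows "gen_mean r k a > 0"
proof -
  have "(\<Prod>i=1..k. a i) > 0"
    using assms(2) by (intro prod_pos) auto
  \<comment> \<open>A \<open>powr\<close> is positive exactly when its base is nonzero, so a
    positive base suffices for any exponent.\<close>
  then have "(\<Prod>i=1..k. a i) powr (1 / real k) > 0"
    by (simp only: powr_gt_zero)
  moreover have "(\<Sum>i=1..k. a i powr r) > 0"
    using assms by (intro sum_pos) (auto simp: less_imp_neq[symmetric])
  then have "((1 / real k) * (\<Sum>i=1..k. a i powr r)) powr (1 / r) > 0"
    using assms(1) by simp
  ultimately show ?thesis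
    by (simp only: gen_mean_def split: if_split) simp
qed

text \<open>For \<open>r = 0\<close> this is the equality \<open>ln\<close> of product = sum of
  \<open>ln\<close>. For \<open>r > 0\<close> it is Jensen's inequality for the concave
  \<open>ln\<close> at the points \<open>a i powr r\<close> with equal weights.\<close>

lemma mean_ln_le_ln_gen_mean:
  assumes k: "k \<ge> 1" and pos: "\<And>i. i \<in> {1..k} \<Longrightarrow> a i > 0" and r: "r \<ge> 0"
  shows "(1 / real k) * (\<Sum>i=1..k. ln (a i)) \<le> ln (gen_mean r k a)"
proof (cases "r = 0")
  case True
  have "ln (\<Prod>i=1..k. a i) = (\<Sum>i=1..k. ln (a i))"
    using pos by (intro ln_prod) (auto simp: less_imp_neq[symmetric])
  then show ?thesis
    using True by (simp add: gen_mean_def ln_powr)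
next
  case False
  have "(\<Sum>i=1..k. (1 / real k) * ln (a i powr r)) \<le> ln (\<Sum>i=1..k. (1 / real k) *\<^sub>R (a i powr r))"
  proof (rule concave_on_sum)
    show "a i powr r \<in> {0<..}" if "i \<in> {1..k}" for i
      using pos[OF that] by simp
  qed (use k ln_concave in auto)
  also have "(\<Sum>i=1..k. (1 / real k) * ln (a i powr r)) = r * ((1 / real k) * (\<Sum>i=1..k. ln (a i)))"
    by (simp add: ln_powr sum_distrib_left mult.left_commute sum_divide_distrib)
  \<comment> \<open>The \<open>ln\<close> of the outer power \<open>1 / r\<close> contributes the
    factor \<open>1 / r\<close>, which cancels the \<open>r\<close> pulled out of the sum because
    \<open>r > 0\<close> here.\<close>
  finally show ?thesis
    using False r
    by (simp add: gen_mean_def ln_powr sum_divide_distrib pos_le_divide_eq mult.commute)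
qed

text \<open>For \<open>r = 0\<close> this is the AM-GM inequality. For \<open>0 < r\<close> it is
  Jensen's inequality for the map sending \<open>t\<close> to \<open>t powr (1 / r)\<close>, at the
  points \<open>a i powr r\<close>; the bound \<open>r \<le> 1\<close> makes the exponent at least 1
  and hence the map convex.\<close>

lemma gen_mean_le_arith_mean:
  assumes k: "k \<ge> 1" and pos: "\<And>i. i \<in> {1..k} \<Longrightarrow> a i > 0" and r: "0 \<le> r" "r \<le> 1"
  shows "gen_mean r k a \<le> (1 / real k) * (\<Sum>i=1..k. a i)"
proof (cases "r = 0")
  case True
  have "(\<Prod>i\<in>{1..k}. a i) powr (1 / card {1..k}) \<le> (\<Sum>i\<in>{1..k}. a i / card {1..k})"
    using k pos by (intro arith_geom_mean) (auto intro: less_imp_le)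
  then show ?thesis
    using True by (simp add: gen_mean_def sum_divide_distrib)
next
  case False
  have "(\<Sum>i=1..k. (1 / real k) *\<^sub>R (a i powr r)) powr (1 / r)
      \<le> (\<Sum>i=1..k. (1 / real k) * (a i powr r) powr (1 / r))"
  proof (rule convex_on_sum[OF _ _ powr_convex])
    show "1 \<le> 1 / r"
      using False r by simp
    show "a i powr r \<in> {0<..}" if "i \<in> {1..k}" for i
      using pos[OF that] by simp
  qed (use k in auto)
  also have "(\<Sum>i=1..k. (1 / real k) * (a i powr r) powr (1 / r)) = (\<Sum>i=1..k. (1 / real k) * a i)"
  proof (rule sum.cong)
    show "(1 / real k) * (a i powr r) powr (1 / r) = (1 / real k) * a i" if "i \<in> {1..k}" for i
      using pos[OF that] False by (simp add: powr_powr)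
  qed simp
  finally show ?thesis
    using False by (simp add: gen_mean_def sum_divide_distrib)
qed

lemma integrable_prob_density: "prob_density M p \<Longrightarrow> integrable M p"
  unfolding prob_density_def by (metis not_integrable_integral_eq zero_neq_one)

lemma pointwise_mean_measurable:
  assumes "\<And>i. i \<in> {1..k} \<Longrightarrow> p i \<in> borel_measurable M"
  shows "pointwise_mean k r p \<in> borel_measurable M"
proof -
  have [measurable]: "(\<lambda>x. \<Prod>i=1..k. p i x) \<in> borel_measurable M"
    using assms by (intro borel_measurable_prod) auto
  have [measurable]: "(\<lambda>x. \<Sum>i=1..k. p i x powr r) \<in> borel_measurable M"
    using assms by (intro borel_measurable_sum powr_real_measurable) auto
  have "(\<lambda>x. pointwise_mean k r p x) \<in> borel_measurable M"
    unfolding pointwise_mean_def gen_mean_def by measurable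
  then show ?thesis
    by simp
qed

text \<open>Both bounds compare the pointwise mean with the arithmetic mean of the densities, which
  is itself a density and so has integral 1.\<close>

lemma norm_const_bounds:
  assumes k: "k \<ge> 1" and dens: "\<And>i. i \<in> {1..k} \<Longrightarrow> prob_density M (p i)"
    and pos: "\<And>i x. i \<in> {1..k} \<Longrightarrow> x \<in> space M \<Longrightarrow> p i x > 0"
    and r: "0 \<le> r" "r \<le> 1"
  shows "0 < norm_const M k r p" and "norm_const M k r p \<le> 1"
proof -
  let ?m = "pointwise_mean k r p" and ?a = "\<lambda>x. (1 / real k) * (\<Sum>i=1..k. p i x)"
  have le: "?m x \<le> ?a x" if "x \<in> space M" for x
    unfolding pointwise_mean_def using that k pos r by (intro gen_mean_le_arith_mean)
  have gt: "0 < ?m x" if "x \<in> space M" for x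
    unfolding pointwise_mean_def using that k pos by (intro gen_mean_pos)
  have int_a: "integrable M ?a"
    using dens by (intro integrable_mult_right Bochner_Integration.integrable_sum)
      (auto intro: integrable_prob_density)
  \<comment> \<open>Integrability rules out the default value 0 of the Bochner integral; it follows
    by domination, since \<open>0 < ?m x \<le> ?a x\<close> on the space.\<close>
  have int_m: "integrable M ?m"
  proof (rule Bochner_Integration.integrable_bound[OF int_a])
    show "?m \<in> borel_measurable M"
      using dens by (intro pointwise_mean_measurable) (auto simp: prob_density_def)
    show "AE x in M. norm (?m x) \<le> norm (?a x)"
      using le gt by (intro AE_I2) (metis abs_ge_self abs_of_pos order.trans real_norm_def)
  qed
  have int_a_eq: "integral\<^sup>L M ?a = 1"
  proof -
    have "integral\<^sup>L M ?a = (1 / real k) * (\<Sum>i=1..k. integral\<^sup>L M (p i))"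
      using dens by (simp add: Bochner_Integration.integral_sum integrable_prob_density)
    also have "(\<Sum>i=1..k. integral\<^sup>L M (p i)) = real k"
      using dens by (simp add: prob_density_def)
    finally show ?thesis
      using k by simp
  qed
  then show "norm_const M k r p \<le> 1"
    unfolding norm_const_def using integral_mono[OF int_m int_a le] by simp
  have "integral\<^sup>L M ?m \<noteq> 0"
  proof
    assume "integral\<^sup>L M ?m = 0"
    then have "AE x in M. ?m x = 0"
      using integral_nonneg_eq_0_iff_AE[OF int_m] gt by (simp add: AE_I2 less_imp_le)
    \<comment> \<open>As \<open>?m\<close> is positive on the whole space, vanishing almost
      everywhere means that the space is a null set. Then every integral is 0, against the value 1
      for \<open>?a\<close>.\<close>
    then have "AE x in M. False"
      using AE_space
    proof eventually_elim
      case (elim x)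
      then show ?case
        using gt[of x] by simp
    qed
    then have "integral\<^sup>L M ?a = integral\<^sup>L M (\<lambda>x. 0)"
      using int_a by (intro integral_cong_AE) auto
    then show False
      using int_a_eq by simp
  qed
  moreover have "0 \<le> integral\<^sup>L M ?m"
    using gt by (intro Bochner_Integration.integral_nonneg) (simp add: less_imp_le)
  ultimately show "0 < norm_const M k r p"
    by (simp add: norm_const_def)
qed

theorem theorem3p1:
  fixes M :: "'a measure" and k :: nat and p :: "nat \<Rightarrow> 'a \<Rightarrow> real" and r :: real
  assumes "k \<ge> 1"
    and "\<And>i. i \<in> {1..k} \<Longrightarrow> prob_density M (p i)"
    and "\<And>i x. i \<in> {1..k} \<Longrightarrow> x \<in> space M \<Longrightarrow> p i x > 0"
    and "0 \<le> r" and "r \<le> 1"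
  shows "\<forall>x\<in>space M. ln (normalized_mean M k r p x) \<ge> (1 / real k) * (\<Sum>i=1..k. ln (p i x))"
proof
  fix x assume x: "x \<in> space M"
  let ?Z = "norm_const M k r p"
  have Z: "0 < ?Z" "?Z \<le> 1"
    using norm_const_bounds[of k M p r] assms by blast+
  have m: "0 < pointwise_mean k r p x"
    unfolding pointwise_mean_def using x assms by (intro gen_mean_pos) auto
  have "(1 / real k) * (\<Sum>i=1..k. ln (p i x)) \<le> ln (pointwise_mean k r p x)"
    unfolding pointwise_mean_def using x assms by (intro mean_ln_le_ln_gen_mean) auto
  \<comment> \<open>Dividing by \<open>?Z\<close> subtracts \<open>ln ?Z\<close>, which is at most 0
    because \<open>0 < ?Z \<le> 1\<close>.\<close>
  also have "\<dots> \<le> ln (normalized_mean M k r p x)"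
    unfolding normalized_mean_def using Z m by (simp add: ln_div)
  finally show "(1 / real k) * (\<Sum>i=1..k. ln (p i x)) \<le> ln (normalized_mean M k r p x)" .
qed

end
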